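(* Let $n,k$ be two positive integers with $n>37(k-1)^2+3$. Then $$ex^{lin}_4(n,M_k)=g(n,k).$$
   Context: A quadruple system (4-uniform hypergraph) consists of a finite vertex set and a set of 4-element subsets of it, called edges or quadruples. It is linear if every pair of vertices is contained in at most one edge. It is $F$-free if it contains no subhypergraph isomorphic to $F$ (not necessarily induced). $ex^{lin}_4(n,F)$ is the maximum number of edges in an $F$-free linear quadruple system on $n$ vertices. $M_k$ is the 4-matching with $k$ edges, i.e. $k$ pairwise disjoint quadruples. $g(n,k)$ denotes the maximum number of quadruples that can intersect a fixed $(k-1)$-element vertex subset in a linear quadruple system on $n$ vertices; that is, the maximum, over all linear quadruple systems $H$ on $n$ vertices and all $(k-1)$-element subsets $A\subseteq V(H)$, of the number of edges $e\in E(H)$ with $e\cap A\ne\emptyset$. *)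

theory Defs
  imports Main
begin

text \<open>A hypergraph is a pair of a vertex set and a set of edges.\<close>

type_synonym 'a hypergraph = "'a set \<times> 'a set set"

abbreviation verts :: "'a hypergraph \<Rightarrow> 'a set" where
  "verts H \<equiv> fst H"

abbreviation edges :: "'a hypergraph \<Rightarrow> 'a set set" where
  "edges H \<equiv> snd H"

definition quadruple_system :: "'a hypergraph \<Rightarrow> bool" where
  "quadruple_system H \<longleftrightarrow>
     finite (verts H) \<and> (\<forall>e \<in> edges H. e \<subseteq> verts H \<and> card e = 4)"

definition linear_hypergraph :: "'a hypergraph \<Rightarrow> bool" where
  "linear_hypergraph H \<longleftrightarrow>
     (\<forall>x \<in> verts H. \<forall>y \<in> verts H. x \<noteq> y \<longrightarrow>
        (\<forall>e \<in> edges H. \<forall>f \<in> edges H. {x, y} \<subseteq> e \<and> {x, y} \<subseteq> f \<longrightarrow> e = f))"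

definition linear_quadruple_system :: "'a hypergraph \<Rightarrow> bool" where
  "linear_quadruple_system H \<longleftrightarrow> quadruple_system H \<and> linear_hypergraph H"

text \<open>Not necessarily induced.\<close>

definition subhypergraph :: "'a hypergraph \<Rightarrow> 'a hypergraph \<Rightarrow> bool" where
  "subhypergraph H' H \<longleftrightarrow>
     verts H' \<subseteq> verts H \<and> edges H' \<subseteq> edges H \<and> (\<forall>e \<in> edges H'. e \<subseteq> verts H')"

definition isomorphic :: "'a hypergraph \<Rightarrow> 'b hypergraph \<Rightarrow> bool" where
  "isomorphic H F \<longleftrightarrow>
     (\<exists>\<phi>. bij_betw \<phi> (verts H) (verts F) \<and> (\<lambda>e. \<phi> ` e) ` edges H = edges F)"

definition free_of :: "'b hypergraph \<Rightarrow> 'a hypergraph \<Rightarrow> bool" where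
  "free_of F H \<longleftrightarrow> \<not> (\<exists>H'. subhypergraph H' H \<and> isomorphic H' F)"

text \<open>
  Vertices of the host systems are taken to be natural numbers. This loses no generality, since
  every finite hypergraph is isomorphic to one whose vertices are natural numbers. The set under
  \<^const>\<open>Max\<close> is finite (the values are at most \<open>n choose 4\<close>); it is nonempty whenever \<open>F\<close> has an
  edge, since then the edgeless system is admissible.
\<close>

definition ex_lin4 :: "nat \<Rightarrow> 'b hypergraph \<Rightarrow> nat" where
  "ex_lin4 n F =
     Max {card (edges H) | H :: nat hypergraph.
            linear_quadruple_system H \<and> card (verts H) = n \<and> free_of F H}"

text \<open>The matching with edges \<open>{0,1,2,3}, {4,5,6,7}, \<dots>, {4k-4,4k-3,4k-2,4k-1}\<close>.\<close>

definition matching4 :: "nat \<Rightarrow> nat hypergraph" where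
  "matching4 k = ({..<4 * k}, (\<lambda>i. {4 * i..<4 * i + 4}) ` {..<k})"

text \<open>
  The set under \<^const>\<open>Max\<close> is finite, and it is nonempty for \<open>k - 1 \<le> n\<close>. The truncated
  subtraction is harmless for \<open>k \<ge> 1\<close>.
\<close>

definition g :: "nat \<Rightarrow> nat \<Rightarrow> nat" where
  "g n k =
     Max {card {e \<in> edges H. e \<inter> A \<noteq> {}} | (H :: nat hypergraph) A.
            linear_quadruple_system H \<and> card (verts H) = n \<and>
            A \<subseteq> verts H \<and> card A = k - 1}"

end

theory Submission
  imports Defs
begin

text \<open>
  Put \<open>s = k - 1\<close>. The edges of a linear quadruple system that meet a set of \<open>s\<close> vertices contain
  no \<open>k\<close> pairwise disjoint edges, by the pigeonhole principle, so the Turan number is at least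
  \<^term>\<open>g n k\<close>.

  Conversely, let \<open>E\<close> be a linear quadruple system without \<open>k\<close> disjoint edges, and let \<open>L\<close> be the
  set of vertices of degree more than \<open>4 * s\<close>. Two edges through \<open>v\<close> share only \<open>v\<close>, so a set of
  \<open>4 * s\<close> vertices other than \<open>v\<close> cannot block all edges through a vertex \<open>v \<in> L\<close>; hence disjoint
  edges can be chosen greedily through the vertices of \<open>L\<close>, even in addition to given disjoint edges
  that avoid \<open>L\<close>, until there are \<open>k\<close> of them (\<open>greedy_matching\<close>). Therefore \<open>L\<close> has some \<open>t \<le> s\<close>
  elements, and at most \<open>s - t\<close> disjoint edges avoid \<open>L\<close>. Every edge avoiding \<open>L\<close> meets
  one of these if they form a maximal matching, and the degrees outside \<open>L\<close> are at most \<open>4 * s\<close>, so at most \<open>(s - t) * (16 * s - 3)\<close>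
  edges avoid \<open>L\<close> (\<open>card_edges_if_maximal_matching\<close>).

  Discard these edges. All the others meet \<open>L\<close>, so a vertex outside \<open>L\<close> has degree at most \<open>t\<close> and
  is joined to few other vertices. Hence almost all of the remaining vertices split into triples
  that span no covered pair, and these can be joined to a new centre to form new edges. As \<open>n\<close> is
  large, one new centre contributes at least \<open>16 * s - 3\<close> edges
  (\<open>add_centre\<close>, \<open>add_centres\<close>). With \<open>s - t\<close> new
  centres nothing has been lost, and now \<open>s\<close> vertices meet all edges; so \<open>E\<close> has at most
  \<^term>\<open>g n k\<close> edges.
\<close>

section \<open>Degrees in linear quadruple systems\<close>

abbreviation edges_at :: "'a set set \<Rightarrow> 'a \<Rightarrow> 'a set set" where
  "edges_at E v \<equiv> {e \<in> E. v \<in> e}"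

definition closed_nbhd :: "'a set set \<Rightarrow> 'a \<Rightarrow> 'a set" where
  "closed_nbhd E v = insert v (\<Union> (edges_at E v))"

lemma linear_quadruple_system_iff:
  "linear_quadruple_system (V, E) \<longleftrightarrow>
     finite V \<and> (\<forall>e\<in>E. e \<subseteq> V \<and> card e = 4) \<and>
     (\<forall>e\<in>E. \<forall>f\<in>E. \<forall>x y. x \<noteq> y \<longrightarrow> x \<in> e \<longrightarrow> y \<in> e \<longrightarrow> x \<in> f \<longrightarrow> y \<in> f \<longrightarrow> e = f)"
  unfolding linear_quadruple_system_def quadruple_system_def linear_hypergraph_def
  by (simp; blast)

lemma
  assumes "linear_quadruple_system (V, E)"
  shows lqs_finite_verts: "finite V"
    and lqs_edge_subset: "e \<in> E \<Longrightarrow> e \<subseteq> V"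
    and lqs_card_edge: "e \<in> E \<Longrightarrow> card e = 4"
    and lqs_linear: "\<lbrakk>e \<in> E; f \<in> E; x \<noteq> y; x \<in> e; y \<in> e; x \<in> f; y \<in> f\<rbrakk> \<Longrightarrow> e = f"
  using assms unfolding linear_quadruple_system_iff by (auto | metis)+

lemma lqs_finite_edge:
  assumes "linear_quadruple_system (V, E)" "e \<in> E" shows "finite e"
  using lqs_card_edge[OF assms] by (metis card.infinite zero_neq_numeral)

lemma lqs_finite_edges:
  assumes "linear_quadruple_system (V, E)" shows "finite E"
  using lqs_finite_verts[OF assms] lqs_edge_subset[OF assms]
  by (meson PowI finite_Pow_iff finite_subset subsetI)

lemma lqs_card_edges_le:
  assumes "linear_quadruple_system (V, E)" shows "card E \<le> 2 ^ card V"
  using lqs_finite_verts[OF assms] lqs_edge_subset[OF assms]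
  by (metis PowI card_Pow card_mono finite_Pow_iff subsetI)

lemma lqs_subset:
  assumes "linear_quadruple_system (V, E)" "F \<subseteq> E"
  shows "linear_quadruple_system (V, F)"
  using assms unfolding linear_quadruple_system_iff by (meson subsetD)

text \<open>
  Two edges through \<open>v\<close> have no other common vertex, so different edges need different blocking
  vertices.
\<close>

lemma card_edges_at_meeting_le:
  assumes E: "linear_quadruple_system (V, E)" and "finite U" "v \<notin> U"
  shows "card {e \<in> edges_at E v. e \<inter> U \<noteq> {}} \<le> card U"
proof -
  let ?X = "{e \<in> edges_at E v. e \<inter> U \<noteq> {}}"
  define h where "h e = (SOME x. x \<in> e \<inter> U)" for e
  have h: "h e \<in> e \<inter> U" if "e \<in> ?X" for e
    unfolding h_def using that by (intro someI_ex[of "\<lambda>x. x \<in> e \<inter> U"]) blast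
  have "inj_on h ?X"
  proof (rule inj_onI)
    fix e f assume ef: "e \<in> ?X" "f \<in> ?X" "h e = h f"
    have "h e \<noteq> v" using h[OF ef(1)] \<open>v \<notin> U\<close> by auto
    thus "e = f" using ef h[OF ef(1)] h[OF ef(2)] lqs_linear[OF E, of e f v "h e"] by auto
  qed
  moreover have "h ` ?X \<subseteq> U" using h by blast
  ultimately show ?thesis using \<open>finite U\<close> by (rule card_inj_on_le)
qed

lemma degree_le_card_cover:
  assumes E: "linear_quadruple_system (V, E)" and "finite S" "\<forall>e\<in>E. e \<inter> S \<noteq> {}" "v \<notin> S"
  shows "card (edges_at E v) \<le> card S"
proof -
  have "edges_at E v = {e \<in> edges_at E v. e \<inter> S \<noteq> {}}" using assms(3) by auto
  thus ?thesis using card_edges_at_meeting_le[OF E assms(2,4)] by simp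
qed

lemma closed_nbhd_sym: "x \<in> closed_nbhd E y \<longleftrightarrow> y \<in> closed_nbhd E x"
  unfolding closed_nbhd_def by auto

lemma finite_closed_nbhd:
  assumes "linear_quadruple_system (V, E)" shows "finite (closed_nbhd E v)"
  unfolding closed_nbhd_def
  using lqs_finite_edges[OF assms] lqs_finite_edge[OF assms] by auto

lemma card_closed_nbhd_le:
  assumes E: "linear_quadruple_system (V, E)"
  shows "card (closed_nbhd E v) \<le> 3 * card (edges_at E v) + 1"
proof -
  have fin: "finite (edges_at E v)" using lqs_finite_edges[OF E] by simp
  have "closed_nbhd E v = insert v (\<Union>e\<in>edges_at E v. e - {v})"
    unfolding closed_nbhd_def by auto
  moreover have "card (\<Union>e\<in>edges_at E v. e - {v}) \<le> (\<Sum>e\<in>edges_at E v. card (e - {v}))"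
    by (rule card_UN_le[OF fin])
  moreover have "(\<Sum>e\<in>edges_at E v. card (e - {v})) = (\<Sum>e\<in>edges_at E v. 3)"
    using lqs_card_edge[OF E] lqs_finite_edge[OF E] by (intro sum.cong) auto
  ultimately show ?thesis
    using card_insert_le_m1[of "Suc (3 * card (edges_at E v))" "\<Union>e\<in>edges_at E v. e - {v}" v] by simp
qed

section \<open>Matchings\<close>

definition matching_in :: "'a set set \<Rightarrow> 'a set set \<Rightarrow> bool" where
  "matching_in E M \<longleftrightarrow> M \<subseteq> E \<and> finite M \<and> pairwise disjnt M"

lemma card_Union_matching:
  assumes E: "linear_quadruple_system (V, E)" and M: "matching_in E M"
  shows "card (\<Union>M) = 4 * card M"
proof -
  have "card (\<Union>M) = sum card M"
    using M lqs_finite_edge[OF E] unfolding matching_in_def by (intro card_Union_disjoint) auto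
  also have "\<dots> = (\<Sum>e\<in>M. 4)"
    using M lqs_card_edge[OF E] unfolding matching_in_def by (intro sum.cong) auto
  finally show ?thesis by simp
qed

text \<open>
  The edges are chosen one by one through the vertices of \<open>L\<close>. Each has to avoid the vertices used
  so far and the rest of \<open>L\<close>, which is needed later; these are at most \<open>4 * s\<close> vertices.
\<close>

lemma greedy_matching:
  assumes E: "linear_quadruple_system (V, E)"
  assumes "matching_in E M" "finite L" "L \<inter> \<Union>M = {}" "card M + card L \<le> Suc s"
    and "\<forall>v\<in>L. 4 * s < card (edges_at E v)"
  shows "\<exists>M'. matching_in E M' \<and> card M' = card M + card L"
  using assms(2-)
proof (induction "card L" arbitrary: L M)
  case 0
  thus ?case by (intro exI[of _ M]) auto
next
  case (Suc l)
  then obtain v L' where L: "L = insert v L'" "v \<notin> L'" "card L' = l"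
    by (metis card_Suc_eq)
  note M = Suc.prems(1)
  have fin: "finite (\<Union>M)" "finite L'" "finite M"
    using M lqs_finite_edge[OF E] Suc.prems(2) L unfolding matching_in_def by auto
  let ?U = "\<Union>M \<union> L'"
  have vU: "v \<notin> ?U" using L Suc.prems(3) by auto
  have "card ?U \<le> 4 * card M + l"
    using card_Un_le[of "\<Union>M" L'] card_Union_matching[OF E M] L by simp
  also have "\<dots> \<le> 4 * s" using Suc.prems(4) Suc.hyps(2) by simp
  finally have "card {e \<in> edges_at E v. e \<inter> ?U \<noteq> {}} < card (edges_at E v)"
    using card_edges_at_meeting_le[OF E _ vU] fin Suc.prems(5) L
    by (metis (no_types, lifting) finite_UnI insertI1 le_less_trans)
  hence "{e \<in> edges_at E v. e \<inter> ?U \<noteq> {}} \<noteq> edges_at E v" by (metis less_irrefl)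
  then obtain e where e: "e \<in> E" "v \<in> e" "e \<inter> ?U = {}" by blast
  hence eM: "e \<notin> M" using vU by auto
  have cM: "card (insert e M) = Suc (card M)" using eM fin by simp
  have cL: "card L = Suc (card L')" using Suc.hyps(2) L(3) by simp
  have "matching_in E (insert e M)"
    using M e unfolding matching_in_def by (auto simp: pairwise_insert disjnt_def)
  moreover have "L' \<inter> \<Union> (insert e M) = {}" using e L Suc.prems(3) by auto
  moreover have "card (insert e M) + card L' \<le> Suc s"
    using Suc.prems(4) cL cM by linarith
  moreover have "\<forall>v\<in>L'. 4 * s < card (edges_at E v)" using Suc.prems(5) L by blast
  ultimately have "\<exists>M'. matching_in E M' \<and> card M' = card (insert e M) + card L'"
    by (rule Suc.hyps(1)[OF L(3)[symmetric] _ fin(2)])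
  thus ?case using cM cL by simp
qed

lemma ex_maximal_matching:
  assumes "finite E" "{} \<notin> E"
  obtains M where "matching_in E M" "\<forall>e\<in>E. e \<inter> \<Union>M \<noteq> {}"
proof -
  let ?P = "\<lambda>M. matching_in E M"
  have "?P {}" unfolding matching_in_def by auto
  moreover have "\<forall>M. ?P M \<longrightarrow> card M < Suc (card E)"
    using \<open>finite E\<close> unfolding matching_in_def by (simp add: card_mono le_imp_less_Suc)
  ultimately obtain M where M: "?P M" "\<forall>N. ?P N \<longrightarrow> card N \<le> card M"
    using ex_has_greatest_nat[of ?P "{}" card "Suc (card E)"] by (metis less_imp_le_nat)
  have "e \<inter> \<Union>M \<noteq> {}" if e: "e \<in> E" for e
  proof
    assume d: "e \<inter> \<Union>M = {}"
    hence "e \<notin> M" using assms(2) e by (metis Int_absorb2 Union_upper)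
    hence "card (insert e M) = Suc (card M)" using M(1) unfolding matching_in_def by simp
    moreover have "?P (insert e M)"
      using M(1) e d unfolding matching_in_def by (auto simp: pairwise_insert disjnt_def)
    hence "card (insert e M) \<le> card M" using M(2) by blast
    ultimately show False by simp
  qed
  thus thesis using M that by blast
qed

text \<open>An edge \<open>e\<close> is met by itself and, at each of its four vertices, by at most \<open>d - 1\<close> others.\<close>

lemma card_edges_meeting_edge_le:
  assumes E: "linear_quadruple_system (V, E)" and e: "e \<in> E"
    and deg: "\<forall>v\<in>e. card (edges_at E v) \<le> d"
  shows "card {f \<in> E. f \<inter> e \<noteq> {}} \<le> 4 * d - 3"
proof -
  have fe: "finite e" "card e = 4" using lqs_finite_edge[OF E e] lqs_card_edge[OF E e] by auto
  have fE: "finite E" by (rule lqs_finite_edges[OF E])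
  have pos: "1 \<le> d"
  proof -
    obtain v where "v \<in> e" using fe by fastforce
    hence "edges_at E v \<noteq> {}" using e by auto
    hence "0 < card (edges_at E v)" using fE by (simp add: card_gt_0_iff)
    thus ?thesis using deg \<open>v \<in> e\<close> by fastforce
  qed
  have "{f \<in> E. f \<inter> e \<noteq> {}} \<subseteq> insert e (\<Union>v\<in>e. edges_at E v - {e})" by auto
  hence "card {f \<in> E. f \<inter> e \<noteq> {}} \<le> card (insert e (\<Union>v\<in>e. edges_at E v - {e}))"
    using fE fe by (intro card_mono) auto
  also have "\<dots> \<le> Suc (card (\<Union>v\<in>e. edges_at E v - {e}))" by (rule card_insert_le_m1) auto
  also have "card (\<Union>v\<in>e. edges_at E v - {e}) \<le> (\<Sum>v\<in>e. card (edges_at E v - {e}))"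
    by (rule card_UN_le[OF fe(1)])
  also have "\<dots> \<le> (\<Sum>v\<in>e. d - 1)"
    using deg e fE by (intro sum_mono) (auto simp: card_Diff_singleton_if diff_le_mono)
  also have "\<dots> = 4 * (d - 1)" using fe by simp
  finally show ?thesis using pos by simp
qed

lemma card_edges_if_maximal_matching:
  assumes E: "linear_quadruple_system (V, E)" and M: "matching_in E M"
    and max: "\<forall>e\<in>E. e \<inter> \<Union>M \<noteq> {}"
    and deg: "\<forall>v\<in>\<Union>E. card (edges_at E v) \<le> d"
  shows "card E \<le> card M * (4 * d - 3)"
proof -
  have "E \<subseteq> (\<Union>e\<in>M. {f \<in> E. f \<inter> e \<noteq> {}})" using max by blast
  hence "card E \<le> card (\<Union>e\<in>M. {f \<in> E. f \<inter> e \<noteq> {}})"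
    using M lqs_finite_edges[OF E] unfolding matching_in_def by (intro card_mono) auto
  also have "\<dots> \<le> (\<Sum>e\<in>M. card {f \<in> E. f \<inter> e \<noteq> {}})"
    using M unfolding matching_in_def by (intro card_UN_le) auto
  also have "\<dots> \<le> (\<Sum>e\<in>M. 4 * d - 3)"
    using M deg unfolding matching_in_def
    by (intro sum_mono card_edges_meeting_edge_le[OF E]) auto
  finally show ?thesis by simp
qed

text \<open>Disjoint edges that all meet \<open>A\<close> use up different elements of \<open>A\<close>.\<close>

lemma card_matching_le_cover:
  assumes "finite A" "pairwise disjnt M" "\<forall>e\<in>M. e \<inter> A \<noteq> {}"
  shows "card M \<le> card A"
proof -
  define h where "h e = (SOME x. x \<in> e \<inter> A)" for e
  have h: "h e \<in> e \<inter> A" if "e \<in> M" for e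
    unfolding h_def using that assms(3) by (intro someI_ex[of "\<lambda>x. x \<in> e \<inter> A"]) blast
  have "inj_on h M"
  proof (rule inj_onI, rule ccontr)
    fix e f assume "e \<in> M" "f \<in> M" "h e = h f" "e \<noteq> f"
    thus False using h[of e] h[of f] assms(2) unfolding pairwise_def disjnt_def by auto
  qed
  moreover have "h ` M \<subseteq> A" using h by blast
  ultimately show ?thesis using assms(1) by (rule card_inj_on_le)
qed

section \<open>Adding a centre\<close>

definition independent_triple :: "('a \<Rightarrow> 'a set) \<Rightarrow> 'a set \<Rightarrow> bool" where
  "independent_triple N t \<longleftrightarrow> card t = 3 \<and> (\<forall>x\<in>t. \<forall>y\<in>t. x \<noteq> y \<longrightarrow> y \<notin> N x)"

text \<open>
  As long as more than \<open>2 * c\<close> elements are left, two of them with their neighbourhoods do not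
  exhaust the set, so another independent triple can be split off.
\<close>

lemma independent_triple_packing:
  assumes "finite W" "\<And>x. finite (N x)" "\<And>x y. x \<in> N y \<longleftrightarrow> y \<in> N x" "\<And>x. x \<in> N x"
    and "\<forall>x\<in>W. card (N x) \<le> c"
  shows "\<exists>T. finite T \<and> pairwise disjnt T \<and>
           (\<forall>t\<in>T. t \<subseteq> W \<and> independent_triple N t) \<and>
           card W \<le> 3 * card T + 2 * c"
  using assms(1,5)
proof (induction "card W" arbitrary: W rule: less_induct)
  case less
  show ?case
  proof (cases "card W \<le> 2 * c")
    case True
    thus ?thesis by (intro exI[of _ "{}"]) auto
  next
    case False
    then obtain x where x: "x \<in> W" by fastforce
    have "card (N x) < card W" using less.prems(2) x False by fastforce
    hence "\<not> W \<subseteq> N x" using assms(2) by (metis card_mono not_le)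
    then obtain y where y: "y \<in> W" "y \<notin> N x" by blast
    have "card (N x \<union> N y) \<le> 2 * c"
      using card_Un_le[of "N x" "N y"] less.prems(2)[rule_format, OF x]
        less.prems(2)[rule_format, OF y(1)] by linarith
    hence "\<not> W \<subseteq> N x \<union> N y" using False assms(2) by (metis card_mono finite_UnI le_trans)
    then obtain z where z: "z \<in> W" "z \<notin> N x" "z \<notin> N y" by blast
    let ?t = "{x, y, z}"
    have ne: "x \<noteq> y" "x \<noteq> z" "y \<noteq> z" using y z assms(4) by auto
    have ct: "card ?t = 3" using ne by simp
    have sub: "?t \<subseteq> W" using x y z by auto
    have cW: "card (W - ?t) + 3 = card W"
      using card_Diff_subset[of ?t W] card_mono[OF less.prems(1) sub] sub ct by simp
    obtain T where T: "finite T" "pairwise disjnt T"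
      "\<forall>t\<in>T. t \<subseteq> W - ?t \<and> independent_triple N t"
      "card (W - ?t) \<le> 3 * card T + 2 * c"
    proof -
      have "card (W - ?t) < card W" "finite (W - ?t)" "\<forall>x\<in>W - ?t. card (N x) \<le> c"
        using cW less.prems by auto
      from less.hyps[OF this] show thesis by (elim exE conjE) (rule that)
    qed
    have sT: "t \<subseteq> W - ?t" if "t \<in> T" for t using T(3) that by (metis (no_types))
    hence dT: "disjnt ?t t" if "t \<in> T" for t using that unfolding disjnt_def by blast
    have "?t \<notin> T"
    proof
      assume "?t \<in> T"
      from sT[OF this] show False by simp
    qed
    hence "card (insert ?t T) = Suc (card T)" using T(1) by simp
    hence c_ins: "card W \<le> 3 * card (insert ?t T) + 2 * c" using T(4) cW by linarith
    have p_ins: "pairwise disjnt (insert ?t T)"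
      using T(2) dT disjnt_sym by (simp add: pairwise_insert)
    have "\<forall>u\<in>?t. \<forall>v\<in>?t. u \<noteq> v \<longrightarrow> v \<notin> N u"
      using y(2) z(2,3) assms(3)[of x y] assms(3)[of x z] assms(3)[of y z] by simp
    hence "independent_triple N ?t" unfolding independent_triple_def using ct by blast
    hence "\<forall>t\<in>insert ?t T. t \<subseteq> W \<and> independent_triple N t" using T(3) sub by blast
    thus ?thesis using T(1) c_ins p_ins by (intro exI[of _ "insert ?t T"]) simp
  qed
qed

text \<open>
  An independent triple for the relation of lying on a common edge, all three elements of which are
  also unrelated to \<open>v\<close>, forms an admissible new edge with \<open>v\<close>. For \<open>card S = j\<close> the closed
  neighbourhoods outside \<open>S\<close> have at most \<open>3 * j + 1\<close> elements, so \<open>j\<close> elements of \<open>S\<close>, the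
  neighbourhood of \<open>v\<close> and \<open>2 * (3 * j + 1)\<close> uncovered vertices are all that is lost, which is
  \<open>10 * j + 3\<close> altogether.
\<close>

lemma add_centre:
  assumes E: "linear_quadruple_system (V, E)" and "S \<subseteq> V" and v: "v \<in> V - S"
    and cover: "\<forall>e\<in>E. e \<inter> S \<noteq> {}"
  shows "\<exists>F. linear_quadruple_system (V, F) \<and> (\<forall>e\<in>F. e \<inter> insert v S \<noteq> {}) \<and>
           card V + 3 * card E \<le> 3 * card F + 10 * card S + 3"
proof -
  let ?N = "closed_nbhd E"
  define W where "W = V - S - ?N v"
  have fin: "finite V" "finite S" "finite E"
    using lqs_finite_verts[OF E] lqs_finite_edges[OF E] \<open>S \<subseteq> V\<close> finite_subset by auto
  have cN: "card (?N x) \<le> 3 * card S + 1" if "x \<notin> S" for x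
    using card_closed_nbhd_le[OF E, of x] degree_le_card_cover[OF E fin(2) cover that] by linarith
  have self: "x \<in> ?N x" for x unfolding closed_nbhd_def by simp
  have "finite W" "\<forall>x\<in>W. card (?N x) \<le> 3 * card S + 1"
    using fin cN unfolding W_def by auto
  then obtain T where T: "finite T" "pairwise disjnt T"
    "\<And>t. t \<in> T \<Longrightarrow> t \<subseteq> W" "\<And>t. t \<in> T \<Longrightarrow> independent_triple ?N t"
    "card W \<le> 3 * card T + 2 * (3 * card S + 1)"
    using independent_triple_packing[of W ?N "3 * card S + 1",
        OF _ finite_closed_nbhd[OF E] closed_nbhd_sym self] by blast
  have T3: "card t = 3" if "t \<in> T" for t
    using T(4)[OF that] unfolding independent_triple_def by blast
  have vW: "v \<notin> W" using self unfolding W_def by blast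
  have vt: "v \<notin> t" if "t \<in> T" for t using T(3) that vW by blast
  let ?F = "E \<union> insert v ` T"
  \<comment> \<open>By the choice of \<open>W\<close> and the independence of \<open>t\<close>, no two elements of \<open>insert v t\<close> are neighbours.\<close>
  have old_new: False
    if "e \<in> E" "t \<in> T" "x \<noteq> y" "x \<in> e" "y \<in> e" "x \<in> insert v t" "y \<in> insert v t" for e t x y
  proof -
    have xy: "y \<in> ?N x" using that unfolding closed_nbhd_def by auto
    hence yx: "x \<in> ?N y" using closed_nbhd_sym by metis
    show False
      using that xy yx T(3)[OF that(2)] T(4)[OF that(2)] unfolding W_def independent_triple_def by blast
  qed
  have new_new: "t = u"
    if "t \<in> T" "u \<in> T" "x \<noteq> y" "x \<in> insert v t" "y \<in> insert v t"
      "x \<in> insert v u" "y \<in> insert v u" for t u x y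
    using that T(2) vt unfolding pairwise_def disjnt_def by blast
  have F: "linear_quadruple_system (V, ?F)"
    unfolding linear_quadruple_system_iff
  proof (intro conjI ballI allI impI)
    show "finite V" by (rule fin(1))
  next
    fix e assume "e \<in> ?F"
    thus "e \<subseteq> V" using lqs_edge_subset[OF E] T(3) v unfolding W_def by blast
  next
    fix e assume e: "e \<in> ?F"
    have "card (insert v t) = 4" if "t \<in> T" for t
      using vt[OF that] T3[OF that] card_ge_0_finite[of t] by simp
    thus "card e = 4" using e lqs_card_edge[OF E] by blast
  next
    fix e f x y
    assume "e \<in> ?F" "f \<in> ?F" "x \<noteq> y" "x \<in> e" "y \<in> e" "x \<in> f" "y \<in> f"
    thus "e = f" using lqs_linear[OF E] old_new new_new by (elim UnE imageE) metis+
  qed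
  have covered: "\<forall>e\<in>?F. e \<inter> insert v S \<noteq> {}" using cover by blast
  have cF: "card ?F = card E + card T"
  proof -
    have "E \<inter> insert v ` T = {}"
    proof (rule ccontr)
      assume "E \<inter> insert v ` T \<noteq> {}"
      then obtain t where t: "t \<in> T" "insert v t \<in> E" by blast
      then obtain x where "x \<in> t" using T3 by fastforce
      thus False using old_new[OF t(2,1), of v x] vt[OF t(1)] by auto
    qed
    moreover have "inj_on (insert v) T"
      using vt by (intro inj_onI) (metis insert_ident)
    ultimately show ?thesis using fin(3) T(1) by (simp add: card_Un_disjoint card_image)
  qed
  have cV: "card V \<le> card W + card S + (3 * card S + 1)"
  proof -
    have "V \<subseteq> W \<union> S \<union> ?N v" unfolding W_def by blast
    hence "card V \<le> card (W \<union> S \<union> ?N v)"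
      using fin finite_closed_nbhd[OF E] unfolding W_def by (intro card_mono) auto
    also have "\<dots> \<le> card W + card S + card (?N v)"
      using card_Un_le[of "W \<union> S" "?N v"] card_Un_le[of W S] by linarith
    finally show ?thesis using cN[of v] v by simp
  qed
  have "card V + 3 * card E \<le> 3 * (card E + card T) + 10 * card S + 3"
    using cV T(5) by simp
  thus ?thesis using F covered unfolding cF[symmetric] by blast
qed

text \<open>
  Here the size of the vertex set enters. While fewer than \<open>s\<close> centres are present, a new one gains
  at least \<open>(card V - 10 * (s - 1) - 3) / 3\<close> edges, which the quadratic bound makes at least
  \<open>16 * s - 3\<close>. This number is the bound \<open>4 * d - 3\<close> on the edges that meet a given edge for
  \<open>d = 4 * s\<close>, so one new centre makes up for all that one edge of a maximal matching blocks.
\<close>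

lemma add_centres:
  assumes "linear_quadruple_system (V, E)" "S \<subseteq> V" "\<forall>e\<in>E. e \<inter> S \<noteq> {}"
    and "card S + m = s" "37 * s^2 + 3 < card V"
  shows "\<exists>F A. linear_quadruple_system (V, F) \<and> A \<subseteq> V \<and> card A = s \<and>
           (\<forall>e\<in>F. e \<inter> A \<noteq> {}) \<and> card E + m * (16 * s - 3) \<le> card F"
  using assms
proof (induction m arbitrary: E S)
  case 0
  thus ?case by (intro exI[of _ E] exI[of _ S]) auto
next
  case (Suc m)
  have fin: "finite V" "finite S"
    using lqs_finite_verts[OF Suc.prems(1)] Suc.prems(2) finite_subset by auto
  have "s \<le> s^2" by (cases s) (auto simp: power2_eq_square)
  hence "card S < card V" using Suc.prems(4,5) by linarith
  then obtain v where v: "v \<in> V - S" using fin by (metis DiffI card_mono not_le subsetI)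
  obtain F where F: "linear_quadruple_system (V, F)" "\<forall>e\<in>F. e \<inter> insert v S \<noteq> {}"
    "card V + 3 * card E \<le> 3 * card F + 10 * card S + 3"
    using add_centre[OF Suc.prems(1,2) v Suc.prems(3)] by blast
  \<comment> \<open>For \<open>s = 1\<close> integrality is needed: with \<open>x = card F - card E\<close>, the bound is only \<open>38 \<le> 3 * x\<close>,
    which still yields \<open>13 \<le> x\<close>.\<close>
  have gain: "card E + (16 * s - 3) \<le> card F"
  proof (cases "s = 1")
    case True
    thus ?thesis using F(3) Suc.prems(4,5) by simp
  next
    case False
    hence "2 * s \<le> s^2" using Suc.prems(4) by (simp add: power2_eq_square)
    thus ?thesis using F(3) Suc.prems(4,5) by linarith
  qed
  have "card (insert v S) + m = s" using v fin Suc.prems(4) by simp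
  then obtain F' A where "linear_quadruple_system (V, F')" "A \<subseteq> V" "card A = s"
    "\<forall>e\<in>F'. e \<inter> A \<noteq> {}" "card F + m * (16 * s - 3) \<le> card F'"
    using Suc.IH[OF F(1) _ F(2) _ Suc.prems(5)] v Suc.prems(2) by blast
  thus ?case using gain by (intro exI[of _ F'] exI[of _ A]) auto
qed

section \<open>From bounded matchings to a small cover\<close>

text \<open>
  Edges avoiding the vertices of large degree are few and are traded for new centres, until there are
  exactly \<open>s\<close> of these.
\<close>

lemma covered_system_at_least_as_large:
  assumes E: "linear_quadruple_system (V, E)" and n: "37 * s^2 + 3 < card V"
    and no_matching: "\<nexists>M. matching_in E M \<and> card M = Suc s"
  shows "\<exists>F A. linear_quadruple_system (V, F) \<and> A \<subseteq> V \<and> card A = s \<and>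
           (\<forall>e\<in>F. e \<inter> A \<noteq> {}) \<and> card E \<le> card F"
proof -
  define L where "L = {v \<in> V. 4 * s < card (edges_at E v)}"
  have fin: "finite V" "finite E" "finite L"
    using lqs_finite_verts[OF E] lqs_finite_edges[OF E] unfolding L_def by auto
  have M_L: "card M + card L \<le> s" if M: "matching_in E M" "L \<inter> \<Union>M = {}" for M
  proof (rule ccontr)
    assume large: "\<not> card M + card L \<le> s"
    \<comment> \<open>Trim \<open>M\<close>, and then \<open>L\<close>, until exactly \<open>Suc s\<close> edges result from the greedy choice.\<close>
    have M0: "finite M" "M \<subseteq> E" "pairwise disjnt M" using M unfolding matching_in_def by auto
    obtain K where K: "K \<subseteq> L" "card K = min (card L) (Suc s)"
      using obtain_subset_with_card_n[of "min (card L) (Suc s)" L] by auto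
    have "Suc s - card K \<le> card M" using K(2) large by linarith
    then obtain N where N: "N \<subseteq> M" "card N = Suc s - card K"
      by (rule obtain_subset_with_card_n)
    have "matching_in E N"
      using M0 N unfolding matching_in_def by (auto intro: finite_subset pairwise_subset)
    moreover have "finite K" using K(1) fin(3) by (rule finite_subset)
    moreover have "K \<inter> \<Union>N = {}" using K(1) N(1) M(2) by blast
    moreover have "card N + card K = Suc s" using N(2) K(2) by linarith
    moreover have "\<forall>v\<in>K. 4 * s < card (edges_at E v)" using K(1) unfolding L_def by blast
    ultimately show False using greedy_matching[OF E, of N K s] no_matching by simp
  qed
  define E0 where "E0 = {e \<in> E. e \<inter> L = {}}"
  define E1 where "E1 = {e \<in> E. e \<inter> L \<noteq> {}}"
  have lqs: "linear_quadruple_system (V, E0)" "linear_quadruple_system (V, E1)"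
    using lqs_subset[OF E] unfolding E0_def E1_def by auto
  have "{} \<notin> E0" using lqs_card_edge[OF lqs(1)] by fastforce
  then obtain M where M: "matching_in E0 M" "\<forall>e\<in>E0. e \<inter> \<Union>M \<noteq> {}"
    using ex_maximal_matching lqs_finite_edges[OF lqs(1)] by blast
  have M_small: "card M + card L \<le> s"
    using M(1) unfolding matching_in_def E0_def by (intro M_L) (auto simp: matching_in_def)
  have "\<forall>v\<in>\<Union>E0. card (edges_at E0 v) \<le> 4 * s"
  proof
    fix v assume v: "v \<in> \<Union>E0"
    hence "v \<in> V" "v \<notin> L" using lqs_edge_subset[OF lqs(1)] unfolding E0_def by auto
    hence "card (edges_at E v) \<le> 4 * s" unfolding L_def by simp
    moreover have "card (edges_at E0 v) \<le> card (edges_at E v)"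
      using fin(2) unfolding E0_def by (intro card_mono) auto
    ultimately show "card (edges_at E0 v) \<le> 4 * s" by simp
  qed
  hence "card E0 \<le> card M * (4 * (4 * s) - 3)"
    using card_edges_if_maximal_matching[OF lqs(1) M] by blast
  also have "\<dots> \<le> (s - card L) * (16 * s - 3)"
    using M_small by (intro mult_le_mono) auto
  finally have E0: "card E0 \<le> (s - card L) * (16 * s - 3)" .
  have "E = E0 \<union> E1" unfolding E0_def E1_def by auto
  hence "card E \<le> card E0 + card E1" using card_Un_le by metis
  moreover obtain F A where "linear_quadruple_system (V, F)" "A \<subseteq> V" "card A = s"
    "\<forall>e\<in>F. e \<inter> A \<noteq> {}" "card E1 + (s - card L) * (16 * s - 3) \<le> card F"
    using add_centres[OF lqs(2), of L "s - card L" s] M_small n unfolding L_def E1_def by auto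
  ultimately show ?thesis using E0 by (intro exI[of _ F] exI[of _ A]) auto
qed

section \<open>Freeness from the matching as absence of disjoint edges\<close>

lemma matching4_blocks_disjoint:
  fixes i j :: nat
  assumes "i \<noteq> j" shows "{4 * i..<4 * i + 4} \<inter> {4 * j..<4 * j + 4} = {}"
  using assms by (auto simp: set_eq_iff)

lemma Union_matching4: "\<Union> (edges (matching4 k)) = verts (matching4 k)"
proof -
  have "x \<in> (\<Union>i<k. {4 * i..<4 * i + 4}) \<longleftrightarrow> x < 4 * k" for x
  proof
    assume "x < 4 * k"
    hence "x div 4 \<in> {..<k}" "x \<in> {4 * (x div 4)..<4 * (x div 4) + 4}" by auto
    thus "x \<in> (\<Union>i<k. {4 * i..<4 * i + 4})" by (rule UN_I)
  qed auto
  thus ?thesis unfolding matching4_def by (simp add: set_eq_iff)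
qed

lemma card_edges_matching4: "card (edges (matching4 k)) = k"
proof -
  have "inj_on (\<lambda>i. {4 * i..<4 * i + 4}) {..<k}"
  proof (rule inj_onI, rule ccontr)
    fix i j :: nat
    assume "{4 * i..<4 * i + 4} = {4 * j..<4 * j + 4}" "i \<noteq> j"
    thus False using matching4_blocks_disjoint[of i j] by auto
  qed
  thus ?thesis unfolding matching4_def by (simp add: card_image)
qed

text \<open>
  Each edge of \<open>M\<close> is mapped bijectively onto its own block of four consecutive numbers. As the edges
  are disjoint, every vertex lies in just one of them, and so these maps combine to one map \<open>\<phi>\<close>.
\<close>

lemma isomorphic_matching4:
  assumes "finite M" "pairwise disjnt M" "card M = k" "\<forall>e\<in>M. card e = 4"
  shows "isomorphic (\<Union>M, M) (matching4 k)"
proof -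
  obtain h where h: "bij_betw h M {..<k}"
    using ex_bij_betw_finite_nat[OF assms(1)] assms(3) by (metis atLeast0LessThan)
  let ?B = "\<lambda>e. {4 * h e..<4 * h e + 4}"
  have "\<exists>p. bij_betw p e (?B e)" if "e \<in> M" for e
    using assms(4) that by (intro finite_same_card_bij) (auto intro: card_ge_0_finite)
  then obtain p where p: "\<And>e. e \<in> M \<Longrightarrow> bij_betw (p e) e (?B e)" by metis
  define \<phi> where "\<phi> x = p (THE e. e \<in> M \<and> x \<in> e) x" for x
  have \<phi>: "\<phi> x = p e x" if "e \<in> M" "x \<in> e" for e x
  proof -
    have "(THE e. e \<in> M \<and> x \<in> e) = e"
      using that assms(2) unfolding pairwise_def disjnt_def by (intro the_equality) blast+
    thus ?thesis unfolding \<phi>_def by simp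
  qed
  have img: "\<phi> ` e = ?B e" if "e \<in> M" for e
    using p[OF that] \<phi>[OF that] unfolding bij_betw_def by (metis image_cong)
  have edges: "(\<lambda>e. \<phi> ` e) ` M = edges (matching4 k)"
  proof -
    have "(\<lambda>e. \<phi> ` e) ` M = (\<lambda>i. {4 * i..<4 * i + 4}) ` h ` M"
      using img by (auto simp: image_image)
    thus ?thesis using h unfolding matching4_def bij_betw_def by simp
  qed
  have "\<phi> ` \<Union>M = \<Union> ((\<lambda>e. \<phi> ` e) ` M)" by blast
  hence "\<phi> ` \<Union>M = verts (matching4 k)" using edges Union_matching4 by metis
  moreover have "inj_on \<phi> (\<Union>M)"
  proof (rule inj_onI)
    fix x y assume "x \<in> \<Union>M" "y \<in> \<Union>M" and eq: "\<phi> x = \<phi> y"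
    then obtain e f where ef: "e \<in> M" "x \<in> e" "f \<in> M" "y \<in> f" by blast
    have "\<phi> x \<in> ?B e \<inter> ?B f" using img ef eq by (metis IntI imageI)
    hence "h e = h f" using matching4_blocks_disjoint by blast
    hence "e = f" using h ef unfolding bij_betw_def inj_on_def by blast
    thus "x = y" using eq \<phi> ef p[of e] unfolding bij_betw_def inj_on_def by metis
  qed
  ultimately show ?thesis
    unfolding isomorphic_def using edges
    by (intro exI[of _ \<phi>]) (simp add: bij_betw_def)
qed

lemma isomorphic_matching4_imp_matching:
  assumes sub: "\<forall>e\<in>E. e \<subseteq> V" and iso: "isomorphic (V, E) (matching4 k)"
  shows "pairwise disjnt E \<and> card E = k"
proof -
  obtain \<phi> where \<phi>: "inj_on \<phi> V" "(\<lambda>e. \<phi> ` e) ` E = edges (matching4 k)"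
    using iso unfolding isomorphic_def bij_betw_def by auto
  have inj: "inj_on (\<lambda>e. \<phi> ` e) E"
    using sub \<phi>(1) by (intro inj_onI) (metis inj_on_image_eq_iff)
  hence "card E = k" using \<phi>(2) card_edges_matching4 by (metis card_image)
  moreover have "pairwise disjnt E"
    unfolding pairwise_def disjnt_def
  proof (intro ballI impI)
    fix e f assume ef: "e \<in> E" "f \<in> E" "e \<noteq> f"
    hence "\<phi> ` e \<noteq> \<phi> ` f" using inj unfolding inj_on_def by blast
    moreover have "\<phi> ` e \<in> edges (matching4 k)" "\<phi> ` f \<in> edges (matching4 k)"
      using \<phi>(2) ef by blast+
    then obtain i j where "\<phi> ` e = {4 * i..<4 * i + 4}" "\<phi> ` f = {4 * j..<4 * j + 4}"
      unfolding matching4_def snd_conv by (elim imageE)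
    ultimately have "\<phi> ` e \<inter> \<phi> ` f = {}"
      using matching4_blocks_disjoint[of i j] by (cases "i = j") auto
    thus "e \<inter> f = {}" by blast
  qed
  ultimately show ?thesis by blast
qed

lemma free_of_matching4_iff:
  assumes E: "linear_quadruple_system (V, E)"
  shows "free_of (matching4 k) (V, E) \<longleftrightarrow> (\<nexists>M. matching_in E M \<and> card M = k)"
proof -
  have "\<exists>H'. subhypergraph H' (V, E) \<and> isomorphic H' (matching4 k)"
    if M: "matching_in E M" "card M = k" for M
  proof -
    have "isomorphic (\<Union>M, M) (matching4 k)"
      using M lqs_card_edge[OF E] unfolding matching_in_def by (intro isomorphic_matching4) auto
    moreover have "subhypergraph (\<Union>M, M) (V, E)"
      using M lqs_edge_subset[OF E] unfolding matching_in_def subhypergraph_def by auto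
    ultimately show ?thesis by blast
  qed
  moreover have "\<exists>M. matching_in E M \<and> card M = k"
    if H: "subhypergraph H' (V, E)" "isomorphic H' (matching4 k)" for H'
  proof -
    have "pairwise disjnt (edges H') \<and> card (edges H') = k"
      using isomorphic_matching4_imp_matching[of "edges H'" "verts H'" k] H
      unfolding subhypergraph_def by simp
    moreover have "finite (edges H')"
      using H(1) lqs_finite_edges[OF E] finite_subset unfolding subhypergraph_def by auto
    ultimately show ?thesis using H(1) unfolding matching_in_def subhypergraph_def by auto
  qed
  ultimately show ?thesis unfolding free_of_def by blast
qed

section \<open>The Turan number of the matching\<close>

theorem theorem1p5:
  fixes n k :: nat
  assumes "n > 0" and "k > 0"
    and "n > 37 * (k - 1)^2 + 3"
  shows "ex_lin4 n (matching4 k) = g n k"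
proof -
  define s where "s = k - 1"
  have k: "k = Suc s" using assms(2) unfolding s_def by simp
  define X where "X = {card (edges H) | H :: nat hypergraph.
     linear_quadruple_system H \<and> card (verts H) = n \<and> free_of (matching4 k) H}"
  define Y where "Y = {card {e \<in> edges H. e \<inter> A \<noteq> {}} | (H :: nat hypergraph) A.
     linear_quadruple_system H \<and> card (verts H) = n \<and> A \<subseteq> verts H \<and> card A = k - 1}"
  have finX: "finite X"
  proof (rule finite_subset)
    show "X \<subseteq> {..2 ^ n}" unfolding X_def using lqs_card_edges_le by fastforce
  qed simp
  have YX: "Y \<subseteq> X"
  proof
    fix y assume "y \<in> Y"
    then obtain V A and E :: "nat set set" where E: "linear_quadruple_system (V, E)"
      and card: "card V = n" "A \<subseteq> V" "card A = s" and y: "y = card {e \<in> E. e \<inter> A \<noteq> {}}"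
      unfolding Y_def s_def by auto
    let ?F = "{e \<in> E. e \<inter> A \<noteq> {}}"
    have F: "linear_quadruple_system (V, ?F)" by (rule lqs_subset[OF E]) auto
    have "finite A" using card(2) lqs_finite_verts[OF E] finite_subset by auto
    hence "card M \<le> s" if "matching_in ?F M" for M
      using that card_matching_le_cover[of A M] card(3) unfolding matching_in_def by auto
    hence "free_of (matching4 k) (V, ?F)"
      unfolding free_of_matching4_iff[OF F] k by (metis Suc_n_not_le_n)
    thus "y \<in> X" unfolding X_def mem_Collect_eq
      using F card(1) y by (intro exI[of _ "(V, ?F)"]) simp
  qed
  have XY: "\<exists>y\<in>Y. x \<le> y" if x_in: "x \<in> X" for x
  proof -
    obtain V and E :: "nat set set" where E: "linear_quadruple_system (V, E)"
      and card: "card V = n" and free: "free_of (matching4 k) (V, E)" and x: "x = card E"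
      using x_in unfolding X_def by auto
    obtain F A where F: "linear_quadruple_system (V, F)" "A \<subseteq> V" "card A = s"
      "\<forall>e\<in>F. e \<inter> A \<noteq> {}" "card E \<le> card F"
      using covered_system_at_least_as_large[OF E, of s] assms(3) card free
      unfolding free_of_matching4_iff[OF E] k by auto
    have "{e \<in> F. e \<inter> A \<noteq> {}} = F" using F(4) by auto
    hence "card F \<in> Y"
      unfolding Y_def s_def[symmetric] mem_Collect_eq using F(1-3) card
      by (intro exI[of _ "(V, F)"] exI[of _ A]) simp
    thus ?thesis using F(5) x by blast
  qed
  have "Y \<noteq> {}"
  proof -
    have "linear_quadruple_system ({..<n}, {} :: nat set set)"
      unfolding linear_quadruple_system_iff by simp
    moreover have "s \<le> s^2" by (cases s) (auto simp: power2_eq_square)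
    hence "{..<s} \<subseteq> {..<n}" using assms(3) unfolding s_def[symmetric] by auto
    ultimately have "0 \<in> Y"
      unfolding Y_def s_def[symmetric] mem_Collect_eq
      by (intro exI[of _ "({..<n}, {})"] exI[of _ "{..<s}"]) simp
    thus ?thesis by blast
  qed
  hence "X \<noteq> {}" "finite Y" using YX finX finite_subset by auto
  have "Max X = Max Y"
  proof (rule antisym)
    show "Max X \<le> Max Y"
      using XY finX \<open>X \<noteq> {}\<close> \<open>finite Y\<close> by (meson Max_in Max_ge le_trans)
    show "Max Y \<le> Max X" using YX \<open>Y \<noteq> {}\<close> finX by (rule Max_mono)
  qed
  thus ?thesis unfolding ex_lin4_def g_def X_def Y_def .
qed

end
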